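(* Suppose $\mathcal Z=\{\bm z\in\mathbb R^d:\bm A\bm z\ge \bm b\}$ is a nonempty bounded polyhedron, with $\bm A\in\mathbb R^{m\times d}$, $\bm b\in\mathbb R^m$, and fix $a>0$ and $\gamma>0$. Let $\{(\bm x_i,\bm y_i)\}_{i=1}^N$ be a sample, $\{\bm g_\theta:\theta\in\Theta\}$ a prediction class, $\Omega$ a regularizer and $\lambda\ge 0$. Then the problem $$\min_{\theta\in\Theta}\ \frac1N\sum_{i=1}^N \ell_{\mathcal{RSPO}_+}(\bm g_\theta(\bm x_i),\bm y_i)+\lambda\,\Omega(\bm g_\theta)\qquad (\mathrm{P})$$ is equivalent to $$\min_{\theta\in\Theta,\ \bm p_1,\dots,\bm p_N\in\mathbb R^m_+}\ \frac1N\sum_{i=1}^N\Big\{\frac{1}{2a\gamma}\big\|\bm y_i-a\bm g_\theta(\bm x_i)+\bm A^\top\bm p_i\big\|_2^2-\bm b^\top\bm p_i+a\,\bm z^\star_\gamma(\bm y_i)^\top\bm g_\theta(\bm x_i)+\frac{a\gamma}{2}\|\bm z^\star_\gamma(\bm y_i)\|_2^2-v^\star(\bm y_i)\Big\}+\lambda\,\Omega(\bm g_\theta)\qquad(\mathrm{P}')$$ in the sense that the two problems have the same optimal value, and $\theta^\star$ is optimal for $(\mathrm P)$ if and only if there exist $\bm p_1^\star,\dots,\bm p_N^\star$ such that $(\theta^\star,\{\bm p_i^\star\})$ is optimal for $(\mathrm P')$.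
   Context: For a nonempty compact convex $\mathcal Z\subseteq\mathbb R^d$ and $\gamma>0$: $v^\star(\bm y)=\min_{\bm z\in\mathcal Z}\bm y^\top\bm z$, and $\bm z^\star_\gamma(\bm y)$ is the unique minimizer over $\bm z\in\mathcal Z$ of $\bm y^\top\bm z+\frac{\gamma}{2}\|\bm z\|_2^2$. For fixed $a>0$ the $\mathcal{RSPO}_+$ loss is $$\ell_{\mathcal{RSPO}_+}(\hat{\bm y},\bm y)=\max_{\bm z\in\mathcal Z}\Big\{\bm y^\top\bm z-a\hat{\bm y}^\top\bm z-\frac{a\gamma}{2}\|\bm z\|_2^2\Big\}+a\Big\{\bm z^\star_\gamma(\bm y)^\top\hat{\bm y}+\frac{\gamma}{2}\|\bm z^\star_\gamma(\bm y)\|_2^2\Big\}-v^\star(\bm y).$$ The prediction class is a family of functions $\bm g_\theta:\mathcal X\to\mathbb R^d$ indexed by $\theta\in\Theta$, with $\mathcal X\subseteq\mathbb R^p$; $\bm x_i\in\mathcal X$, $\bm y_i\in\mathbb R^d$; $\Omega$ maps predictors to $[0,\infty)$. *)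

theory Defs
  imports "HOL-Analysis.Analysis"
begin

definition v_star :: "(real ^ 'd) set \<Rightarrow> real ^ 'd \<Rightarrow> real" where
  "v_star Z y = (INF z\<in>Z. y \<bullet> z)"

definition z_star :: "real \<Rightarrow> (real ^ 'd) set \<Rightarrow> real ^ 'd \<Rightarrow> real ^ 'd" where
  "z_star \<gamma> Z y = (THE z. is_arg_min (\<lambda>z. y \<bullet> z + \<gamma> / 2 * (norm z)\<^sup>2) (\<lambda>z. z \<in> Z) z)"

definition rspo_loss :: "real \<Rightarrow> real \<Rightarrow> (real ^ 'd) set \<Rightarrow> real ^ 'd \<Rightarrow> real ^ 'd \<Rightarrow> real" where
  "rspo_loss a \<gamma> Z yh y =
     (SUP z\<in>Z. y \<bullet> z - a * (yh \<bullet> z) - a * \<gamma> / 2 * (norm z)\<^sup>2)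
     + a * (z_star \<gamma> Z y \<bullet> yh + \<gamma> / 2 * (norm (z_star \<gamma> Z y))\<^sup>2)
     - v_star Z y"

text \<open>The infimum and the supremum above are attained, and the minimizer is unique, for every
  nonempty compact convex feasible set.\<close>

lemma v_star_is_min:
  assumes "compact Z" "Z \<noteq> {}"
  shows "\<exists>z\<in>Z. v_star Z y = y \<bullet> z \<and> (\<forall>z'\<in>Z. y \<bullet> z \<le> y \<bullet> z')"
proof -
  have "continuous_on Z (\<lambda>z. y \<bullet> z)" by (intro continuous_intros)
  then obtain z where z: "z \<in> Z" "\<And>z'. z' \<in> Z \<Longrightarrow> y \<bullet> z \<le> y \<bullet> z'"
    using continuous_attains_inf[OF assms] by blast
  have "v_star Z y = y \<bullet> z"
    unfolding v_star_def by (rule cInf_eq_minimum) (use z in auto)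
  with z show ?thesis by blast
qed

lemma rspo_sup_is_max:
  fixes Z :: "(real ^ 'd) set" and y yh :: "real ^ 'd" and a \<gamma> :: real
  defines "f \<equiv> \<lambda>z. y \<bullet> z - a * (yh \<bullet> z) - a * \<gamma> / 2 * (norm z)\<^sup>2"
  assumes "compact Z" "Z \<noteq> {}"
  shows "\<exists>z\<in>Z. (SUP z\<in>Z. f z) = f z \<and> (\<forall>z'\<in>Z. f z' \<le> f z)"
proof -
  have "continuous_on Z f" unfolding f_def by (intro continuous_intros)
  then obtain z where z: "z \<in> Z" "\<And>z'. z' \<in> Z \<Longrightarrow> f z' \<le> f z"
    using continuous_attains_sup[OF assms(2,3)] by blast
  have "(SUP z\<in>Z. f z) = f z"
    by (rule cSup_eq_maximum) (use z in auto)
  with z show ?thesis by blast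
qed

lemma z_star_ex1:
  fixes Z :: "(real ^ 'd) set"
  assumes "compact Z" "convex Z" "Z \<noteq> {}" "0 < \<gamma>"
  shows "\<exists>!z. is_arg_min (\<lambda>z. y \<bullet> z + \<gamma> / 2 * (norm z)\<^sup>2) (\<lambda>z. z \<in> Z) z"
proof -
  let ?c = "- (1 / \<gamma>) *\<^sub>R y"
  have "(dist ?c z)\<^sup>2 = (norm y)\<^sup>2 / \<gamma>\<^sup>2 + 2 * (y \<bullet> z) / \<gamma> + (norm z)\<^sup>2" for z
    unfolding dist_norm power2_norm_eq_inner
    by (simp add: inner_diff_left inner_diff_right inner_commute power2_eq_square)
  then have sq: "y \<bullet> z + \<gamma> / 2 * (norm z)\<^sup>2
      = \<gamma> / 2 * (dist ?c z)\<^sup>2 - (norm y)\<^sup>2 / (2 * \<gamma>)" for z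
    using assms(4) by (simp add: field_simps power2_eq_square)
  have le: "y \<bullet> z + \<gamma> / 2 * (norm z)\<^sup>2 \<le> y \<bullet> z' + \<gamma> / 2 * (norm z')\<^sup>2
      \<longleftrightarrow> dist ?c z \<le> dist ?c z'" for z z'
    unfolding sq using assms(4) by (simp add: abs_le_square_iff[symmetric])
  have eq: "is_arg_min (\<lambda>z. y \<bullet> z + \<gamma> / 2 * (norm z)\<^sup>2) (\<lambda>z. z \<in> Z) z
      \<longleftrightarrow> z \<in> Z \<and> (\<forall>z'\<in>Z. dist ?c z \<le> dist ?c z')" for z
    unfolding is_arg_min_linorder le by blast
  have cl: "closed Z" using assms(1) compact_imp_closed by blast
  show ?thesis
    unfolding eq
    using closest_point_in_set[OF cl assms(3)] closest_point_le[OF cl]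
      closest_point_unique[OF assms(2) cl]
    by (intro ex1I[of _ "closest_point Z ?c"]) auto
qed

text \<open>Extended-real valued, so that an empty feasible set or an unbounded objective is covered.\<close>

definition opt_value :: "'a set \<Rightarrow> ('a \<Rightarrow> real) \<Rightarrow> ereal" where
  "opt_value S f = (INF s\<in>S. ereal (f s))"

definition is_optimal :: "'a set \<Rightarrow> ('a \<Rightarrow> real) \<Rightarrow> 'a \<Rightarrow> bool" where
  "is_optimal S f s \<longleftrightarrow> is_arg_min f (\<lambda>s. s \<in> S) s"

text \<open>In both objectives \<open>x\<close> and \<open>y\<close> are sequences of which only the entries with index in
  \<open>{1..N}\<close> matter.\<close>

definition primal_obj ::
  "real \<Rightarrow> real \<Rightarrow> (real ^ 'd) set \<Rightarrow> nat \<Rightarrow> (nat \<Rightarrow> real ^ 'p) \<Rightarrow> (nat \<Rightarrow> real ^ 'd) \<Rightarrow>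
   ('t \<Rightarrow> real ^ 'p \<Rightarrow> real ^ 'd) \<Rightarrow> ((real ^ 'p \<Rightarrow> real ^ 'd) \<Rightarrow> real) \<Rightarrow> real \<Rightarrow> 't \<Rightarrow> real" where
  "primal_obj a \<gamma> Z N x y g \<Omega> lam \<theta> =
     1 / real N * (\<Sum>i=1..N. rspo_loss a \<gamma> Z (g \<theta> (x i)) (y i)) + lam * \<Omega> (g \<theta>)"

definition dual_obj ::
  "real ^ 'd ^ 'm \<Rightarrow> real ^ 'm \<Rightarrow>
   real \<Rightarrow> real \<Rightarrow> (real ^ 'd) set \<Rightarrow> nat \<Rightarrow> (nat \<Rightarrow> real ^ 'p) \<Rightarrow> (nat \<Rightarrow> real ^ 'd) \<Rightarrow>
   ('t \<Rightarrow> real ^ 'p \<Rightarrow> real ^ 'd) \<Rightarrow> ((real ^ 'p \<Rightarrow> real ^ 'd) \<Rightarrow> real) \<Rightarrow> real \<Rightarrow>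
   't \<times> (nat \<Rightarrow> real ^ 'm) \<Rightarrow> real" where
  "dual_obj A b a \<gamma> Z N x y g \<Omega> lam = (\<lambda>(\<theta>, p).
     1 / real N * (\<Sum>i=1..N.
         1 / (2 * a * \<gamma>) * (norm (y i - a *\<^sub>R g \<theta> (x i) + transpose A *v p i))\<^sup>2
         - b \<bullet> p i
         + a * (z_star \<gamma> Z (y i) \<bullet> g \<theta> (x i))
         + a * \<gamma> / 2 * (norm (z_star \<gamma> Z (y i)))\<^sup>2
         - v_star Z (y i))
     + lam * \<Omega> (g \<theta>))"

text \<open>The order on \<open>real ^ 'm\<close> is componentwise, so \<open>{0..}\<close> is the nonnegative orthant. An
  \<open>N\<close>-tuple of multipliers is an extensional function on \<open>{1..N}\<close>.\<close>

definition dual_feasible :: "'t set \<Rightarrow> nat \<Rightarrow> ('t \<times> (nat \<Rightarrow> real ^ 'm)) set" where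
  "dual_feasible \<Theta> N = \<Theta> \<times> ({1..N} \<rightarrow>\<^sub>E {0..})"

end

theory Submission
  imports Defs
begin

text \<open>
  For fixed \<open>\<theta>\<close> and \<open>i\<close>, the maximum in the loss is the strictly concave quadratic programme
  \<open>max {w \<bullet> z - c/2 * \<parallel>z\<parallel>\<^sup>2 | A z \<ge> b}\<close> with \<open>w = y\<^sub>i - a g\<^sub>\<theta>(x\<^sub>i)\<close> and \<open>c = a\<gamma>\<close>, and the summand
  of the second problem is its Lagrangian dual. The primal solution is the projection of \<open>w/c\<close>
  onto the polyhedron; its residual lies in the normal cone there, which is generated by the
  active constraints (Farkas), and the coefficients are a multiplier that attains the dual value.
  So the loss is an attained minimum over multipliers, and both problems agree after a partial
  minimisation.
\<close>

text \<open>Finitely generated cones are closed, so a hyperplane strictly separates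
  \<open>v\<close>. Its level \<open>r\<close> is negative because the cone contains 0, and scaling
  inside the cone turns the bound \<open>r\<close> on generators into the bound 0.\<close>

lemma convex_cone_hull_separation:
  fixes S :: "'a::euclidean_space set"
  assumes "finite S" "v \<notin> convex_cone hull S"
  obtains h where "h \<bullet> v < 0" "\<And>s. s \<in> S \<Longrightarrow> 0 \<le> h \<bullet> s"
proof -
  obtain h r where hv: "h \<bullet> v < r" and hS: "\<And>x. x \<in> convex_cone hull S \<Longrightarrow> r < h \<bullet> x"
    using separating_hyperplane_closed_point[OF convex_convex_cone_hull
        closed_convex_cone_hull[OF assms(1)] assms(2)] by blast
  have r: "r < 0"
    using hS[OF convex_cone_hull_contains_0] by simp
  have "0 \<le> h \<bullet> s" if "s \<in> S" for s
  proof (rule ccontr)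
    assume "\<not> 0 \<le> h \<bullet> s"
    then have neg: "h \<bullet> s < 0" by simp
    \<comment> \<open>This multiple of \<open>s\<close> has inner product exactly \<open>r\<close>
      with \<open>h\<close>, whereas cone points lie strictly above \<open>r\<close>.\<close>
    have "(r / (h \<bullet> s)) *\<^sub>R s \<in> convex_cone hull S"
      using that neg r by (intro convex_cone_hull_mul hull_inc) (auto simp: divide_nonpos_nonpos)
    from hS[OF this] neg show False by simp
  qed
  with hv r that show thesis by force
qed

text \<open>Farkas: if \<open>v\<close> were outside the cone of the active rows of
  \<open>A\<close>, a separating \<open>h\<close> would be a feasible direction at \<open>z0\<close>
  with \<open>h \<bullet> v < 0\<close>, contradicting \<open>min\<close>. The last conclusion is
  complementary slackness.\<close>

lemma polyhedron_normal_cone: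
  fixes A :: "real ^ 'd ^ 'm" and b :: "real ^ 'm"
  assumes z0: "b \<le> A *v z0"
    and min: "\<And>z. b \<le> A *v z \<Longrightarrow> 0 \<le> v \<bullet> (z - z0)"
  obtains p where "0 \<le> p" "v = transpose A *v p" "p \<bullet> (A *v z0 - b) = 0"
proof -
  define I where "I = {i. (A *v z0) $ i = b $ i}"
  \<comment> \<open>The active rows are written as images of unit vectors, so that a cone
    combination of rows pulls back to a multiplier vector.\<close>
  let ?E = "(\<lambda>i. axis i (1::real)) ` I"
  let ?f = "\<lambda>p. transpose A *v p"
  have "v \<in> convex_cone hull (?f ` ?E)"
  proof (rule ccontr)
    assume "v \<notin> convex_cone hull (?f ` ?E)"
    then obtain h where hv: "h \<bullet> v < 0" and h: "\<And>s. s \<in> ?f ` ?E \<Longrightarrow> 0 \<le> h \<bullet> s"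
      using convex_cone_hull_separation[of "?f ` ?E" v] by auto
    have active: "0 \<le> (A *v h) $ i" if "i \<in> I" for i
    proof -
      have "h \<bullet> ?f (axis i 1) = (A *v h) $ i"
        by (simp add: inner_commute[of h] dot_lmul_matrix inner_axis')
      with h that show ?thesis by force
    qed
    \<comment> \<open>Moving along \<open>h\<close> cannot decrease an active constraint; an
      inactive one has slack, which survives small \<open>t\<close> by continuity. As there are
      finitely many constraints, one \<open>t\<close> then serves all.\<close>
    have "\<forall>\<^sub>F t in at_right (0::real). b $ i \<le> (A *v (z0 + t *\<^sub>R h)) $ i" for i
    proof (cases "i \<in> I")
      case True
      have "\<forall>\<^sub>F t in at_right (0::real). 0 < t"
        by (rule eventually_at_right_less)
      then show ?thesis
        by eventually_elim
          (use True active[OF True] in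
            \<open>simp add: I_def matrix_vector_right_distrib matrix_vector_mult_scaleR\<close>)
    next
      case False
      then have "b $ i < (A *v z0) $ i"
        using z0 by (simp add: I_def less_eq_vec_def order_less_le)
      moreover have "((\<lambda>t. (A *v z0) $ i + t * (A *v h) $ i) \<longlongrightarrow> (A *v z0) $ i + 0 * (A *v h) $ i)
          (at_right 0)"
        by (intro tendsto_intros)
      ultimately have "\<forall>\<^sub>F t in at_right (0::real). b $ i < (A *v z0) $ i + t * (A *v h) $ i"
        by (intro order_tendstoD(1)) auto
      then show ?thesis
        by eventually_elim (simp add: matrix_vector_right_distrib matrix_vector_mult_scaleR)
    qed
    then have "\<forall>\<^sub>F t in at_right (0::real). \<forall>i. b $ i \<le> (A *v (z0 + t *\<^sub>R h)) $ i"
      by (simp add: eventually_all_finite)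
    moreover have "\<forall>\<^sub>F t in at_right (0::real). 0 < t"
      by (rule eventually_at_right_less)
    ultimately have "\<forall>\<^sub>F t in at_right (0::real). 0 < t \<and> b \<le> A *v (z0 + t *\<^sub>R h)"
      by eventually_elim (simp add: less_eq_vec_def)
    then obtain t where "0 < t" "b \<le> A *v (z0 + t *\<^sub>R h)"
      using eventually_happens'[of "at_right (0::real)"] trivial_limit_at_right_real by blast
    with min[of "z0 + t *\<^sub>R h"] hv show False
      by (simp add: inner_commute zero_le_mult_iff)
  qed
  moreover have "convex_cone hull (?f ` ?E) = ?f ` (convex_cone hull ?E)"
    by (rule convex_cone_hull_linear_image) (rule matrix_vector_mul_linear)
  moreover have "convex_cone hull ?E \<subseteq> {p. 0 \<le> p \<and> (\<forall>i. i \<notin> I \<longrightarrow> p $ i = 0)}"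
    by (rule hull_minimal)
      (auto simp: convex_cone_iff less_eq_vec_def axis_def)
  ultimately obtain p where p: "0 \<le> p" "\<And>i. i \<notin> I \<Longrightarrow> p $ i = 0" "v = ?f p"
    by blast
  have "p \<bullet> (A *v z0 - b) = 0"
    unfolding inner_vec_def by (rule sum.neutral) (use p(2) in \<open>auto simp: I_def\<close>)
  with p that show thesis by blast
qed

lemma inner_nonneg_vec:
  fixes p q :: "real ^ 'm"
  assumes "0 \<le> p" "0 \<le> q"
  shows "0 \<le> p \<bullet> q"
  unfolding inner_vec_def using assms by (auto simp: less_eq_vec_def intro!: sum_nonneg)

text \<open>Completing the square writes the duality gap as a stationarity residual plus a slackness
  term. Both are nonnegative for feasible \<open>z\<close> and \<open>p\<close>, which gives weak
  duality; strong duality needs a pair where both vanish.\<close>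

lemma quadratic_programme_gap:
  fixes A :: "real ^ 'd ^ 'm" and b p :: "real ^ 'm"
  assumes "0 < c"
  shows "(1 / (2 * c) * (norm (w + transpose A *v p))\<^sup>2 - b \<bullet> p) - (w \<bullet> z - c / 2 * (norm z)\<^sup>2)
    = 1 / (2 * c) * (norm (w + transpose A *v p - c *\<^sub>R z))\<^sup>2 + p \<bullet> (A *v z - b)"
proof -
  have "p \<bullet> (A *v z - b) = (transpose A *v p) \<bullet> z - b \<bullet> p"
    by (simp add: dot_lmul_matrix inner_diff_right inner_commute[of b])
  moreover have "(norm (u - c *\<^sub>R z))\<^sup>2 = (norm u)\<^sup>2 - 2 * c * (u \<bullet> z) + c\<^sup>2 * (norm z)\<^sup>2" for u
    unfolding power2_norm_eq_inner
    by (simp add: inner_diff_left inner_diff_right inner_commute power2_eq_square)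
  then have "1 / (2 * c) * (norm (u - c *\<^sub>R z))\<^sup>2
      = 1 / (2 * c) * (norm u)\<^sup>2 - u \<bullet> z + c / 2 * (norm z)\<^sup>2" for u
    using assms by (simp add: field_simps power2_eq_square)
  ultimately show ?thesis
    by (simp only: inner_add_left)
qed

lemma quadratic_programme_weak_duality:
  fixes A :: "real ^ 'd ^ 'm" and b p :: "real ^ 'm"
  assumes "0 < c" "b \<le> A *v z" "0 \<le> p"
  shows "w \<bullet> z - c / 2 * (norm z)\<^sup>2 \<le> 1 / (2 * c) * (norm (w + transpose A *v p))\<^sup>2 - b \<bullet> p"
proof -
  have "0 \<le> p \<bullet> (A *v z - b)"
    using assms by (intro inner_nonneg_vec) (auto simp: less_eq_vec_def)
  moreover have "0 \<le> 1 / (2 * c) * (norm (w + transpose A *v p - c *\<^sub>R z))\<^sup>2"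
    using assms(1) by simp
  ultimately show ?thesis
    using quadratic_programme_gap[OF assms(1), of w A p b z] by linarith
qed

lemma quadratic_programme_strong_duality:
  fixes A :: "real ^ 'd ^ 'm" and b :: "real ^ 'm"
  assumes c: "0 < c" and ne: "{z. b \<le> A *v z} \<noteq> {}"
  obtains z p where "b \<le> A *v z" "0 \<le> p"
    "w \<bullet> z - c / 2 * (norm z)\<^sup>2 = 1 / (2 * c) * (norm (w + transpose A *v p))\<^sup>2 - b \<bullet> p"
proof -
  let ?Z = "{z. b \<le> A *v z}"
  have halfspaces: "?Z = (\<Inter>i. {z. (A $ i) \<bullet> z \<ge> b $ i})"
    by (auto simp: less_eq_vec_def matrix_vector_mul_component)
  have convex: "convex ?Z"
    unfolding halfspaces by (intro convex_INT convex_halfspace_ge)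
  have closed: "closed ?Z"
    unfolding halfspaces by (intro closed_INT ballI closed_halfspace_ge)
  \<comment> \<open>Up to a constant, the objective is \<open>- c / 2\<close> times the squared
    distance from \<open>z\<close> to \<open>w /\<^sub>R c\<close>, so its maximizer is this
    projection.\<close>
  define z0 where "z0 = closest_point ?Z (w /\<^sub>R c)"
  have z0: "b \<le> A *v z0"
    using closest_point_in_set[OF closed ne] by (simp add: z0_def)
  \<comment> \<open>The variational inequality of the projection, multiplied by
    \<open>- c\<close>.\<close>
  have "0 \<le> (c *\<^sub>R z0 - w) \<bullet> (z - z0)" if "b \<le> A *v z" for z
  proof -
    have "(w /\<^sub>R c - z0) \<bullet> (z - z0) \<le> 0"
      unfolding z0_def using that by (intro closest_point_dot[OF convex closed]) simp
    then have "0 \<le> c * - ((w /\<^sub>R c - z0) \<bullet> (z - z0))"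
      using c by (intro mult_nonneg_nonneg) auto
    also have "\<dots> = (c *\<^sub>R z0 - w) \<bullet> (z - z0)"
      using c by (simp add: inner_diff_left field_simps)
    finally show ?thesis .
  qed
  from polyhedron_normal_cone[OF z0 this] obtain p where
    p: "0 \<le> p" "c *\<^sub>R z0 - w = transpose A *v p" "p \<bullet> (A *v z0 - b) = 0"
    by blast
  from p(2) have "w + transpose A *v p - c *\<^sub>R z0 = 0"
    by (metis add.commute diff_add_cancel diff_self)
  with quadratic_programme_gap[OF c, of w A p b z0] p(3)
  have "w \<bullet> z0 - c / 2 * (norm z0)\<^sup>2 = 1 / (2 * c) * (norm (w + transpose A *v p))\<^sup>2 - b \<bullet> p"
    by simp
  with z0 p(1) that show thesis by blast
qed

text \<open>The terms outside the maximum are shared by the loss and \<open>D\<close>, so only the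
  quadratic programme with \<open>c = a * \<gamma>\<close> has to be compared with its dual.\<close>

lemma rspo_loss_minimum_over_multipliers:
  fixes A :: "real ^ 'd ^ 'm" and b :: "real ^ 'm" and yh y :: "real ^ 'd"
  assumes Z: "Z = {z. b \<le> A *v z}" and ne: "Z \<noteq> {}" and a: "0 < a" and \<gamma>: "0 < \<gamma>"
  defines "D \<equiv> \<lambda>p. 1 / (2 * a * \<gamma>) * (norm (y - a *\<^sub>R yh + transpose A *v p))\<^sup>2 - b \<bullet> p
      + a * (z_star \<gamma> Z y \<bullet> yh) + a * \<gamma> / 2 * (norm (z_star \<gamma> Z y))\<^sup>2 - v_star Z y"
  shows "\<And>p. 0 \<le> p \<Longrightarrow> rspo_loss a \<gamma> Z yh y \<le> D p"
    and "\<exists>p\<ge>0. rspo_loss a \<gamma> Z yh y = D p"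
proof -
  define w where "w = y - a *\<^sub>R yh"
  let ?f = "\<lambda>z. w \<bullet> z - a * \<gamma> / 2 * (norm z)\<^sup>2"
  let ?q = "\<lambda>p. 1 / (2 * (a * \<gamma>)) * (norm (w + transpose A *v p))\<^sup>2 - b \<bullet> p"
  have c: "0 < a * \<gamma>" using a \<gamma> by simp
  have loss: "rspo_loss a \<gamma> Z yh y = (SUP z\<in>Z. ?f z)
      + a * (z_star \<gamma> Z y \<bullet> yh) + a * \<gamma> / 2 * (norm (z_star \<gamma> Z y))\<^sup>2 - v_star Z y"
    by (simp add: rspo_loss_def w_def inner_diff_left algebra_simps)
  have D: "D p = ?q p + a * (z_star \<gamma> Z y \<bullet> yh) + a * \<gamma> / 2 * (norm (z_star \<gamma> Z y))\<^sup>2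
      - v_star Z y" for p
    by (simp add: D_def w_def mult.assoc)
  have weak: "?f z \<le> ?q p" if "z \<in> Z" "0 \<le> p" for z p
    using that Z by (intro quadratic_programme_weak_duality[OF c]) auto
  show "rspo_loss a \<gamma> Z yh y \<le> D p" if "0 \<le> p" for p
    unfolding loss D using cSUP_least[OF ne weak[OF _ that]] by simp
  obtain z p where zp: "z \<in> Z" "0 \<le> p" "?f z = ?q p"
    using quadratic_programme_strong_duality[OF c, of b A w] ne unfolding Z by blast
  \<comment> \<open>Weak duality with this same \<open>p\<close> bounds every feasible value by
    \<open>?q p = ?f z\<close>, so \<open>z\<close> is a maximizer.\<close>
  have "(SUP z\<in>Z. ?f z) = ?f z"
    by (rule cSup_eq_maximum[OF imageI[OF zp(1)]]) (use zp weak[OF _ zp(2)] in auto)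
  with zp show "\<exists>p\<ge>0. rspo_loss a \<gamma> Z yh y = D p"
    unfolding loss D by auto
qed

text \<open>Only the inner minimum over \<open>P\<close> has to be attained: the values also agree
  when \<open>S\<close> is empty or \<open>F\<close> is unbounded below.\<close>

lemma partial_minimization:
  fixes F :: "'s \<Rightarrow> real" and G :: "'s \<times> 'p \<Rightarrow> real"
  assumes le: "\<And>s p. s \<in> S \<Longrightarrow> p \<in> P \<Longrightarrow> F s \<le> G (s, p)"
    and attained: "\<And>s. s \<in> S \<Longrightarrow> \<exists>p\<in>P. F s = G (s, p)"
  shows "opt_value S F = opt_value (S \<times> P) G"
    and "is_optimal S F s \<longleftrightarrow> (\<exists>p. is_optimal (S \<times> P) G (s, p))"
proof -
  show "opt_value S F = opt_value (S \<times> P) G"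
    unfolding opt_value_def
  proof (rule antisym)
    show "(INF s\<in>S. ereal (F s)) \<le> (INF t\<in>S \<times> P. ereal (G t))"
    proof (rule INF_greatest)
      fix t assume "t \<in> S \<times> P"
      then show "(INF s\<in>S. ereal (F s)) \<le> ereal (G t)"
        using le by (auto intro!: INF_lower2[of "fst t"])
    qed
    show "(INF t\<in>S \<times> P. ereal (G t)) \<le> (INF s\<in>S. ereal (F s))"
    proof (rule INF_greatest)
      fix s assume "s \<in> S"
      then obtain p where "p \<in> P" "F s = G (s, p)" using attained by blast
      with \<open>s \<in> S\<close> show "(INF t\<in>S \<times> P. ereal (G t)) \<le> ereal (F s)"
        by (auto intro!: INF_lower2[of "(s, p)"])
    qed
  qed
  show "is_optimal S F s \<longleftrightarrow> (\<exists>p. is_optimal (S \<times> P) G (s, p))"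
  proof
    assume "is_optimal S F s"
    then have s: "s \<in> S" "\<And>s'. s' \<in> S \<Longrightarrow> F s \<le> F s'"
      by (auto simp: is_optimal_def is_arg_min_linorder)
    then obtain p where p: "p \<in> P" "F s = G (s, p)" using attained by blast
    have "G (s, p) \<le> G (s', p')" if "s' \<in> S" "p' \<in> P" for s' p'
      using s(2)[OF that(1)] le[OF that] p(2) by linarith
    with s(1) p(1) show "\<exists>p. is_optimal (S \<times> P) G (s, p)"
      by (auto simp: is_optimal_def is_arg_min_linorder)
  next
    assume "\<exists>p. is_optimal (S \<times> P) G (s, p)"
    then obtain p where p: "s \<in> S" "p \<in> P"
      and opt: "\<And>s' p'. s' \<in> S \<Longrightarrow> p' \<in> P \<Longrightarrow> G (s, p) \<le> G (s', p')"
      by (auto simp: is_optimal_def is_arg_min_linorder)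
    have "F s \<le> F s'" if s': "s' \<in> S" for s'
    proof -
      obtain p' where "p' \<in> P" "F s' = G (s', p')" using attained[OF s'] by blast
      \<comment> \<open>The chain is
        \<open>F s \<le> G (s, p) \<le> G (s', p') = F s'\<close>.\<close>
      with opt[OF s'] le[OF p] show ?thesis by force
    qed
    with p(1) show "is_optimal S F s"
      by (auto simp: is_optimal_def is_arg_min_linorder)
  qed
qed

theorem theorem1:
  fixes A :: "real ^ 'd ^ 'm" and b :: "real ^ 'm" and Z :: "(real ^ 'd) set"
    and a \<gamma> lam :: real and N :: nat
    and X :: "(real ^ 'p) set" and x :: "nat \<Rightarrow> real ^ 'p" and y :: "nat \<Rightarrow> real ^ 'd"
    and \<Theta> :: "'t set" and g :: "'t \<Rightarrow> real ^ 'p \<Rightarrow> real ^ 'd"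
    and \<Omega> :: "(real ^ 'p \<Rightarrow> real ^ 'd) \<Rightarrow> real"
  assumes "Z = {z. A *v z \<ge> b}" and "Z \<noteq> {}" and "bounded Z"
    and "a > 0" and "\<gamma> > 0" and "lam \<ge> 0" and "N \<ge> 1"
    and "\<And>i. i \<in> {1..N} \<Longrightarrow> x i \<in> X"
    and "\<And>\<theta>. \<theta> \<in> \<Theta> \<Longrightarrow> g \<theta> \<in> X \<rightarrow>\<^sub>E UNIV"
    and "\<And>\<theta>. \<theta> \<in> \<Theta> \<Longrightarrow> \<Omega> (g \<theta>) \<ge> 0"
  shows "opt_value \<Theta> (primal_obj a \<gamma> Z N x y g \<Omega> lam)
           = opt_value (dual_feasible \<Theta> N) (dual_obj A b a \<gamma> Z N x y g \<Omega> lam)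
       \<and> (\<forall>\<theta>. is_optimal \<Theta> (primal_obj a \<gamma> Z N x y g \<Omega> lam) \<theta> \<longleftrightarrow>
            (\<exists>p. is_optimal (dual_feasible \<Theta> N) (dual_obj A b a \<gamma> Z N x y g \<Omega> lam) (\<theta>, p)))"
proof -
  let ?D = "\<lambda>\<theta> i p. 1 / (2 * a * \<gamma>) * (norm (y i - a *\<^sub>R g \<theta> (x i) + transpose A *v p))\<^sup>2 - b \<bullet> p
      + a * (z_star \<gamma> Z (y i) \<bullet> g \<theta> (x i)) + a * \<gamma> / 2 * (norm (z_star \<gamma> Z (y i)))\<^sup>2
      - v_star Z (y i)"
  let ?P = "{1..N} \<rightarrow>\<^sub>E {0 :: real ^ 'm..}"
  note loss = rspo_loss_minimum_over_multipliers[OF assms(1,2,4,5)]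
  have le: "primal_obj a \<gamma> Z N x y g \<Omega> lam \<theta> \<le> dual_obj A b a \<gamma> Z N x y g \<Omega> lam (\<theta>, p)"
    if "p \<in> ?P" for \<theta> p
    unfolding primal_obj_def dual_obj_def prod.case
    using that by (intro add_right_mono mult_left_mono sum_mono loss(1)) (auto simp: PiE_iff)
  have attained: "\<exists>p\<in>?P. primal_obj a \<gamma> Z N x y g \<Omega> lam \<theta>
      = dual_obj A b a \<gamma> Z N x y g \<Omega> lam (\<theta>, p)" for \<theta>
  proof -
    \<comment> \<open>For fixed \<open>\<theta>\<close> each multiplier occurs in a single summand,
      so the minimization decouples and an optimal one can be chosen index by index.\<close>
    have "\<forall>i. \<exists>q\<ge>0. rspo_loss a \<gamma> Z (g \<theta> (x i)) (y i) = ?D \<theta> i q"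
      using loss(2) by blast
    then obtain q where q: "\<And>i. 0 \<le> q i" "\<And>i. rspo_loss a \<gamma> Z (g \<theta> (x i)) (y i) = ?D \<theta> i (q i)"
      by metis
    show ?thesis
    proof
      \<comment> \<open>Restriction makes the chosen family extensional; the sum only sees indices
        in \<open>{1..N}\<close>.\<close>
      show "restrict q {1..N} \<in> ?P" using q(1) by auto
      show "primal_obj a \<gamma> Z N x y g \<Omega> lam \<theta>
          = dual_obj A b a \<gamma> Z N x y g \<Omega> lam (\<theta>, restrict q {1..N})"
        unfolding primal_obj_def dual_obj_def prod.case q(2)
        by (intro arg_cong2[where f = "(+)"] arg_cong2[where f = "(*)"] sum.cong refl) simp
    qed
  qed
  show ?thesis
    unfolding dual_feasible_def using partial_minimization[OF le attained, where S = \<Theta>] by blast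
qed

end
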